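(* Let $L\subset\mathbb{P}^n$ be a linear space of dimension $d<n$ not contained in a coordinate hyperplane. If $M(L)$ has no coloops and the matroid discriminant variety $\nabla(L^{-1})$ is a hypersurface, then the Newton polytope of $\Delta(L^{-1})$ is a (dilated) standard simplex, i.e. a positive integer dilation of ${\rm Conv}(e_0,\dots,e_n)\subset\mathbb{R}^{n+1}$.
   Context: Work over $\mathbb{C}$. $T\subset\mathbb{P}^n$ is the set of points with all homogeneous coordinates nonzero, and $L^{-1}=\overline{\{(x_0^{-1}:\cdots:x_n^{-1}):x\in L\cap T\}}$. $M(L)$ is the matroid on $\{0,\dots,n\}$ of linear independence of the columns of a $(d+1)\times(n+1)$ matrix $A$ with projectivized row span $L$. The matroid discriminant variety $\nabla(L^{-1})\subset(\mathbb{P}^n)^\vee$ is the projective dual variety of $L^{-1}$ (closure of the set of hyperplanes $z_0x_0+\cdots+z_nx_n=0$ tangent to $L^{-1}$ at a smooth point). When it is a hypersurface, $\Delta(L^{-1})\in\mathbb{C}[z_0,\dots,z_n]$ is its defining (irreducible) polynomial. *)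

theory Defs
  imports
    "HOL-Analysis.Analysis"
    "HOL-Library.Poly_Mapping"
    "HOL-Library.Extended_Nat"
    "HOL-Computational_Algebra.Factorial_Ring"
begin

text \<open>
  Conventions. The homogeneous coordinates of projective \<open>n\<close>-space are indexed by a finite type
  \<open>'n\<close> with \<open>n + 1\<close> elements. A subset of projective space is represented by the set of
  all its homogeneous coordinate vectors, that is, by a set of nonzero vectors of \<open>complex ^ 'n\<close>
  which is stable under nonzero scalars; all Zariski closed sets below are of this kind. The dual
  projective space is represented in the same way: \<open>z\<close> stands for the hyperplane
  \<open>(\<Sum>i\<in>UNIV. z $ i * x $ i) = 0\<close>. A projective linear space of dimension \<open>d\<close> is given by its
  linear subspace of dimension \<open>d + 1\<close>.
\<close>

subsection \<open>Polynomials in the homogeneous coordinates\<close>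

text \<open>An exponent vector is a finitely supported map \<open>'n \<Rightarrow>\<^sub>0 nat\<close>; the product on
  \<open>Poly_Mapping\<close> is the convolution product, i.e. multiplication of polynomials.\<close>

type_synonym 'n cpoly = "('n \<Rightarrow>\<^sub>0 nat) \<Rightarrow>\<^sub>0 complex"

definition eval_cpoly :: "('n::finite) cpoly \<Rightarrow> complex ^ 'n \<Rightarrow> complex" where
  "eval_cpoly f x =
    (\<Sum>m\<in>Poly_Mapping.keys f.
       Poly_Mapping.lookup f m * (\<Prod>i\<in>UNIV. x $ i ^ Poly_Mapping.lookup m i))"

definition homogeneous :: "nat \<Rightarrow> ('n::finite) cpoly \<Rightarrow> bool" where
  "homogeneous k f \<longleftrightarrow>
    (\<forall>m\<in>Poly_Mapping.keys f. (\<Sum>i\<in>UNIV. Poly_Mapping.lookup m i) = k)"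

text \<open>The formal partial derivative. The truncated subtraction of exponents is harmless: when the
  exponent of \<open>i\<close> is \<open>0\<close>, the coefficient vanishes.\<close>

definition partial_deriv :: "'n::finite \<Rightarrow> 'n cpoly \<Rightarrow> 'n cpoly" where
  "partial_deriv i f =
    (\<Sum>m\<in>Poly_Mapping.keys f.
       Poly_Mapping.single (m - Poly_Mapping.single i 1)
         (of_nat (Poly_Mapping.lookup m i) * Poly_Mapping.lookup f m))"

definition newton_polytope :: "('n::finite) cpoly \<Rightarrow> (real ^ 'n) set" where
  "newton_polytope f =
    convex hull ((\<lambda>m. \<chi> i. real (Poly_Mapping.lookup m i)) ` Poly_Mapping.keys f)"

definition standard_simplex :: "(real ^ 'n::finite) set" where
  "standard_simplex = convex hull (range (\<lambda>i. axis i 1))"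


subsection \<open>Zariski topology of projective space\<close>

definition vanishing_forms :: "(complex ^ 'n::finite) set \<Rightarrow> 'n cpoly set" where
  "vanishing_forms S = {f. (\<exists>k. homogeneous k f) \<and> (\<forall>x\<in>S. eval_cpoly f x = 0)}"

definition proj_zeros :: "('n::finite) cpoly set \<Rightarrow> (complex ^ 'n) set" where
  "proj_zeros F = {x. x \<noteq> 0 \<and> (\<forall>f\<in>F. eval_cpoly f x = 0)}"

definition zariski_closed :: "(complex ^ 'n::finite) set \<Rightarrow> bool" where
  "zariski_closed X \<longleftrightarrow> (\<exists>F. (\<forall>f\<in>F. \<exists>k. homogeneous k f) \<and> X = proj_zeros F)"

definition zariski_closure :: "(complex ^ 'n::finite) set \<Rightarrow> (complex ^ 'n) set" where
  "zariski_closure S = proj_zeros (vanishing_forms S)"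

definition zariski_irreducible :: "(complex ^ 'n::finite) set \<Rightarrow> bool" where
  "zariski_irreducible X \<longleftrightarrow> zariski_closed X \<and> X \<noteq> {} \<and>
    (\<forall>Y Z. zariski_closed Y \<longrightarrow> zariski_closed Z \<longrightarrow> X = Y \<union> Z \<longrightarrow> X = Y \<or> X = Z)"

text \<open>The dimension of \<open>X\<close> at \<open>x\<close>, i.e. the Krull dimension of the local ring of \<open>X\<close> at \<open>x\<close>: the
  supremum of the lengths of chains of irreducible closed subsets of \<open>X\<close> through \<open>x\<close>. It is the
  dimension of \<open>X\<close> if \<open>X\<close> is irreducible.\<close>

definition local_dim :: "(complex ^ 'n::finite) set \<Rightarrow> complex ^ 'n \<Rightarrow> enat" where
  "local_dim X x = Sup {enat r | r. \<exists>Z :: nat \<Rightarrow> (complex ^ 'n) set.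
     (\<forall>i\<le>r. zariski_irreducible (Z i) \<and> x \<in> Z i \<and> Z i \<subseteq> X) \<and> (\<forall>i<r. Z i \<subset> Z (Suc i))}"


subsection \<open>Smooth points and the dual variety\<close>

text \<open>The linear subspace whose projectivization is the embedded projective tangent space of \<open>X\<close>
  at \<open>x\<close>.\<close>

definition tangent_space :: "(complex ^ 'n::finite) set \<Rightarrow> complex ^ 'n \<Rightarrow> (complex ^ 'n) set" where
  "tangent_space X x =
    {v. \<forall>f\<in>vanishing_forms X. (\<Sum>i\<in>UNIV. eval_cpoly (partial_deriv i f) x * v $ i) = 0}"

text \<open>The summand \<open>1\<close> accounts for passing from the projective tangent space to the linear space
  above it.\<close>

definition smooth_point :: "(complex ^ 'n::finite) set \<Rightarrow> complex ^ 'n \<Rightarrow> bool" where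
  "smooth_point X x \<longleftrightarrow> x \<in> X \<and> enat (vec.dim (tangent_space X x)) = local_dim X x + 1"

definition hyperplane :: "complex ^ 'n::finite \<Rightarrow> (complex ^ 'n) set" where
  "hyperplane z = {x. (\<Sum>i\<in>UNIV. z $ i * x $ i) = 0}"

definition dual_variety :: "(complex ^ 'n::finite) set \<Rightarrow> (complex ^ 'n) set" where
  "dual_variety X =
    zariski_closure {z. z \<noteq> 0 \<and> (\<exists>x. smooth_point X x \<and> tangent_space X x \<subseteq> hyperplane z)}"

definition is_hypersurface :: "(complex ^ 'n::finite) set \<Rightarrow> bool" where
  "is_hypersurface Y \<longleftrightarrow> (\<exists>k f. k > 0 \<and> f \<noteq> 0 \<and> homogeneous k f \<and> Y = proj_zeros {f})"

text \<open>For an irreducible hypersurface this determines the polynomial up to a nonzero constant.\<close>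

definition is_defining_polynomial ::
    "('n::finite) cpoly \<Rightarrow> (complex ^ 'n) set \<Rightarrow> bool" where
  "is_defining_polynomial f Y \<longleftrightarrow>
    irreducible f \<and> (\<exists>k. homogeneous k f) \<and> Y = proj_zeros {f}"


subsection \<open>Reciprocal linear spaces\<close>

definition torus :: "(complex ^ 'n::finite) set" where
  "torus = {x. \<forall>i. x $ i \<noteq> 0}"

definition reciprocal_linear_space :: "(complex ^ 'n::finite) set \<Rightarrow> (complex ^ 'n) set" where
  "reciprocal_linear_space L = zariski_closure ((\<lambda>x. \<chi> i. inverse (x $ i)) ` (L \<inter> torus))"

definition matroid_discriminant_variety :: "(complex ^ 'n::finite) set \<Rightarrow> (complex ^ 'n) set" where
  "matroid_discriminant_variety L = dual_variety (reciprocal_linear_space L)"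


subsection \<open>Matroids, given by their independent sets\<close>

text \<open>Injectivity is required because columns with different indices may coincide; such columns
  are dependent (parallel).\<close>

definition column_matroid :: "complex ^ 'n::finite ^ 'm::finite \<Rightarrow> 'n set set" where
  "column_matroid A =
    {S. inj_on (\<lambda>j. column j A) S \<and> vec.independent ((\<lambda>j. column j A) ` S)}"

definition matroid_basis :: "'a set set \<Rightarrow> 'a set \<Rightarrow> bool" where
  "matroid_basis M B \<longleftrightarrow> B \<in> M \<and> (\<forall>S\<in>M. B \<subseteq> S \<longrightarrow> B = S)"

definition is_coloop :: "'a set set \<Rightarrow> 'a \<Rightarrow> bool" where
  "is_coloop M e \<longleftrightarrow> (\<forall>B. matroid_basis M B \<longrightarrow> e \<in> B)"

end

theory Submission
  imports Defs
begin

text \<open>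
  The Newton polytope of a form of degree \<open>k\<close> is the full dilated simplex as soon as the form is nonzero
  at all coordinate points \<open>e\<^sub>i\<close>, so it suffices that \<open>e\<^sub>i\<close> is not in the dual variety. At the inverse of a
  torus point \<open>x\<close> of \<open>L\<close>, the tangent hyperplanes are the \<open>z\<close> with \<open>\<Sum>\<^sub>j l\<^sub>j z\<^sub>j / x\<^sub>j\<^sup>2 = 0\<close> for all \<open>l \<in> L\<close>.
  On these pairs \<open>(x, z)\<close>, the coordinate \<open>z\<^sub>i\<close> is integral over the other ones by a homogeneous equation:
  the space \<open>M\<close> of functions of \<open>x\<close> spanned by the monomials with exponents in a suitable permutohedron
  satisfies \<open>z\<^sub>i M \<subseteq> \<Sum>\<^sub>j\<^sub>\<noteq>\<^sub>i z\<^sub>j M\<close>, and eliminating \<open>M\<close> gives a form \<open>\<phi>\<close> in \<open>z\<close> with \<open>\<phi>(e\<^sub>i) = 1\<close> that vanishes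
  on all these \<open>z\<close>. It also vanishes on the conormal vectors at the remaining points of \<open>L\<^sup>-\<^sup>1\<close>, because
  these are combinations of gradients of equations, which extend to conormal vectors on the torus part.
\<close>

subsection \<open>Polynomial functions\<close>

definition monom_fun :: "('n::finite \<Rightarrow>\<^sub>0 nat) \<Rightarrow> complex ^ 'n \<Rightarrow> complex" where
  "monom_fun m x = (\<Prod>i\<in>UNIV. x $ i ^ Poly_Mapping.lookup m i)"

lemma eval_cpoly_monom_fun:
  "eval_cpoly f x = (\<Sum>m\<in>Poly_Mapping.keys f. Poly_Mapping.lookup f m * monom_fun m x)"
  by (simp add: eval_cpoly_def monom_fun_def)

lemma monom_fun_add: "monom_fun (a + b) x = monom_fun a x * monom_fun b x"
  by (simp add: monom_fun_def lookup_add power_add prod.distrib)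

lemma eval_cpoly_zero [simp]: "eval_cpoly 0 x = 0"
  by (simp add: eval_cpoly_def)

lemma eval_cpoly_single: "eval_cpoly (Poly_Mapping.single m c) x = c * monom_fun m x"
  by (simp add: eval_cpoly_monom_fun)

lemma eval_cpoly_add: "eval_cpoly (f + g) x = eval_cpoly f x + eval_cpoly g x"
  unfolding eval_cpoly_monom_fun
  by (rule setsum_keys_plus_distrib) (simp_all add: distrib_right)

lemma eval_cpoly_sum: "eval_cpoly (sum F S) x = (\<Sum>s\<in>S. eval_cpoly (F s) x)"
  by (induction S rule: infinite_finite_induct) (simp_all add: eval_cpoly_add)

text \<open>Forms are handled as functions, so only the existence of a homogeneous polynomial behind
  them has to be tracked. The zero function is a form of every degree.\<close>

definition form :: "nat \<Rightarrow> (complex ^ 'n::finite \<Rightarrow> complex) \<Rightarrow> bool" where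
  "form k \<phi> \<longleftrightarrow> (\<exists>f. homogeneous k f \<and> eval_cpoly f = \<phi>)"

lemma form_zero: "form k (\<lambda>x. 0)"
  unfolding form_def by (rule exI[of _ 0]) (auto simp: homogeneous_def)

lemma form_monom:
  assumes "(\<Sum>i\<in>UNIV. Poly_Mapping.lookup m i) = k"
  shows "form k (\<lambda>x. c * monom_fun m x)"
  unfolding form_def
  by (rule exI[of _ "Poly_Mapping.single m c"])
     (use assms in \<open>auto simp: homogeneous_def eval_cpoly_single\<close>)

lemma form_add:
  assumes "form k \<phi>" and "form k \<psi>"
  shows "form k (\<lambda>x. \<phi> x + \<psi> x)"
proof -
  from assms obtain f g where f: "homogeneous k f" "eval_cpoly f = \<phi>"
    and g: "homogeneous k g" "eval_cpoly g = \<psi>"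
    by (auto simp: form_def)
  have "homogeneous k (f + g)"
    using f(1) g(1) keys_add[of f g] unfolding homogeneous_def by blast
  moreover have "eval_cpoly (f + g) = (\<lambda>x. \<phi> x + \<psi> x)"
    using f(2) g(2) by (auto simp: eval_cpoly_add)
  ultimately show ?thesis by (auto simp: form_def)
qed

lemma form_sum: "(\<And>s. s \<in> S \<Longrightarrow> form k (\<phi> s)) \<Longrightarrow> form k (\<lambda>x. \<Sum>s\<in>S. \<phi> s x)"
  by (induction S rule: infinite_finite_induct) (simp_all add: form_zero form_add)

lemma form_mult:
  assumes "form k \<phi>" and "form l \<psi>"
  shows "form (k + l) (\<lambda>x. \<phi> x * \<psi> x)"
proof -
  from assms obtain f g where f: "homogeneous k f" "eval_cpoly f = \<phi>"
    and g: "homogeneous l g" "eval_cpoly g = \<psi>"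
    by (auto simp: form_def)
  have "(\<lambda>x. \<phi> x * \<psi> x) = (\<lambda>x. \<Sum>a\<in>Poly_Mapping.keys f. \<Sum>b\<in>Poly_Mapping.keys g.
      Poly_Mapping.lookup f a * Poly_Mapping.lookup g b * monom_fun (a + b) x)"
    unfolding f(2)[symmetric] g(2)[symmetric] eval_cpoly_monom_fun monom_fun_add sum_product
    by (simp add: ac_simps)
  moreover have "form (k + l) \<dots>"
    using f(1) g(1)
    by (intro form_sum form_monom) (auto simp: homogeneous_def lookup_add sum.distrib)
  ultimately show ?thesis by simp
qed

lemma form_const: "form 0 (\<lambda>x. c)"
  using form_monom[of 0 0 c] by (simp add: monom_fun_def)

lemma form_cmult: "form k \<phi> \<Longrightarrow> form k (\<lambda>x. c * \<phi> x)"
  using form_mult[OF form_const] by fastforce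

lemma form_coord: "form 1 (\<lambda>x. x $ (i :: 'n::finite))"
proof -
  have "monom_fun (Poly_Mapping.single i 1) x = x $ i" for x :: "complex ^ 'n"
    by (simp add: monom_fun_def lookup_single when_def if_distrib[of "\<lambda>k. _ ^ k"] cong: if_cong)
  then show ?thesis
    using form_monom[of "Poly_Mapping.single i 1" 1 1] by (simp add: lookup_single when_def)
qed

lemma form_power: "form k \<phi> \<Longrightarrow> form (n * k) (\<lambda>x. \<phi> x ^ n)"
  by (induction n) (simp_all add: form_const form_mult)

lemma form_prod:
  "(\<And>s. s \<in> S \<Longrightarrow> form (d s) (\<phi> s)) \<Longrightarrow> form (sum d S) (\<lambda>x. \<Prod>s\<in>S. \<phi> s x)"
  by (induction S rule: infinite_finite_induct) (simp_all add: form_const form_mult)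

text \<open>This pulls a form in \<open>z\<close> back along a family of vectors whose coordinates
  are forms of one common degree.\<close>

lemma form_compose:
  assumes "form k \<phi>" and "\<And>j. form r (\<lambda>x. \<zeta> x $ j)"
  shows "form (k * r) (\<lambda>x. \<phi> (\<zeta> x))"
proof -
  from assms(1) obtain f where f: "homogeneous k f" "eval_cpoly f = \<phi>"
    by (auto simp: form_def)
  have "form (k * r) (\<lambda>x. \<Sum>m\<in>Poly_Mapping.keys f.
      Poly_Mapping.lookup f m * (\<Prod>i\<in>UNIV. \<zeta> x $ i ^ Poly_Mapping.lookup m i))"
  proof (intro form_sum form_cmult)
    fix m assume "m \<in> Poly_Mapping.keys f"
    then have "(\<Sum>i\<in>UNIV. Poly_Mapping.lookup m i * r) = k * r"
      using f(1) by (simp add: homogeneous_def flip: sum_distrib_right)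
    then show "form (k * r) (\<lambda>x. \<Prod>i\<in>UNIV. \<zeta> x $ i ^ Poly_Mapping.lookup m i)"
      using form_prod[of UNIV "\<lambda>i. Poly_Mapping.lookup m i * r"
          "\<lambda>i x. \<zeta> x $ i ^ Poly_Mapping.lookup m i"] form_power assms(2)
      by fastforce
  qed
  then show ?thesis
    by (simp add: f(2)[symmetric] eval_cpoly_def)
qed

section \<open>Formal partial derivatives and the chain rule\<close>

lemma eval_partial_deriv:
  "eval_cpoly (partial_deriv i f) x = (\<Sum>m\<in>Poly_Mapping.keys f.
     of_nat (Poly_Mapping.lookup m i) * Poly_Mapping.lookup f m *
     monom_fun (m - Poly_Mapping.single i 1) x)"
  by (simp add: partial_deriv_def eval_cpoly_sum eval_cpoly_single)

lemma form_partial_deriv: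
  assumes "homogeneous k f"
  shows "form (k - 1) (eval_cpoly (partial_deriv i f))"
proof -
  have "form (k - 1) (\<lambda>x. \<Sum>m\<in>Poly_Mapping.keys f.
     of_nat (Poly_Mapping.lookup m i) * Poly_Mapping.lookup f m *
     monom_fun (m - Poly_Mapping.single i 1) x)"
  proof (rule form_sum)
    fix m assume m: "m \<in> Poly_Mapping.keys f"
    show "form (k - 1) (\<lambda>x. of_nat (Poly_Mapping.lookup m i) * Poly_Mapping.lookup f m *
       monom_fun (m - Poly_Mapping.single i 1) x)"
    \<comment> \<open>A term without the variable \<open>i\<close> has coefficient \<open>0\<close>.
      This covers \<open>k = 0\<close>, where \<open>k - 1\<close> is truncated.\<close>
    proof (cases "Poly_Mapping.lookup m i = 0")
      case False
      have "(\<Sum>j\<in>UNIV. Poly_Mapping.lookup (m - Poly_Mapping.single i 1) j)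
          = (\<Sum>j\<in>UNIV. Poly_Mapping.lookup m j) - (\<Sum>j\<in>UNIV. Poly_Mapping.lookup (Poly_Mapping.single i 1) j)"
        using False unfolding lookup_minus
        by (intro sum_subtractf_nat) (auto simp: lookup_single when_def)
      also have "\<dots> = k - 1"
        using assms m by (simp add: homogeneous_def lookup_single when_def)
      finally show ?thesis by (rule form_monom)
    qed (simp add: form_zero)
  qed
  then show ?thesis
    by (simp add: eval_partial_deriv[abs_def])
qed

lemma eval_cpoly_has_derivative:
  fixes u :: "complex \<Rightarrow> complex ^ 'n::finite"
  assumes u: "\<And>j. ((\<lambda>t. u t $ j) has_field_derivative u' j) (at t)"
  shows "((\<lambda>s. eval_cpoly f (u s)) has_field_derivative
           (\<Sum>i\<in>UNIV. eval_cpoly (partial_deriv i f) (u t) * u' i)) (at t)"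
proof -
  have monom: "of_nat (Poly_Mapping.lookup m i) * u' i * u t $ i ^ (Poly_Mapping.lookup m i - 1) *
      (\<Prod>j\<in>UNIV - {i}. u t $ j ^ Poly_Mapping.lookup m j) =
      of_nat (Poly_Mapping.lookup m i) * monom_fun (m - Poly_Mapping.single i 1) (u t) * u' i" for m i
  proof -
    have "monom_fun (m - Poly_Mapping.single i 1) (u t) = u t $ i ^ (Poly_Mapping.lookup m i - 1) *
        (\<Prod>j\<in>UNIV - {i}. u t $ j ^ Poly_Mapping.lookup (m - Poly_Mapping.single i 1) j)"
      unfolding monom_fun_def
      by (subst prod.remove[of UNIV i]) (simp_all add: lookup_minus lookup_single)
    also have "(\<Prod>j\<in>UNIV - {i}. u t $ j ^ Poly_Mapping.lookup (m - Poly_Mapping.single i 1) j) =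
        (\<Prod>j\<in>UNIV - {i}. u t $ j ^ Poly_Mapping.lookup m j)"
      by (rule prod.cong) (auto simp: lookup_minus lookup_single when_def)
    finally show ?thesis by simp
  qed
  have "((\<lambda>s. eval_cpoly f (u s)) has_field_derivative
      (\<Sum>m\<in>Poly_Mapping.keys f. Poly_Mapping.lookup f m * (\<Sum>i\<in>UNIV.
        of_nat (Poly_Mapping.lookup m i) * u' i * u t $ i ^ (Poly_Mapping.lookup m i - 1) *
        (\<Prod>j\<in>UNIV - {i}. u t $ j ^ Poly_Mapping.lookup m j)))) (at t)"
    unfolding eval_cpoly_def
    by (intro DERIV_sum DERIV_cmult has_field_derivative_prod)
       (auto intro!: derivative_eq_intros u)
  also have "(\<Sum>m\<in>Poly_Mapping.keys f. Poly_Mapping.lookup f m * (\<Sum>i\<in>UNIV.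
        of_nat (Poly_Mapping.lookup m i) * u' i * u t $ i ^ (Poly_Mapping.lookup m i - 1) *
        (\<Prod>j\<in>UNIV - {i}. u t $ j ^ Poly_Mapping.lookup m j))) =
      (\<Sum>i\<in>UNIV. eval_cpoly (partial_deriv i f) (u t) * u' i)"
    unfolding eval_partial_deriv sum_distrib_left sum_distrib_right monom
    by (subst sum.swap) (simp add: ac_simps)
  finally show ?thesis .
qed

subsection \<open>Linear algebra\<close>

text \<open>Induction on \<open>F\<close> for all subspaces at once: the claim for the kernel of
  \<open>\<phi> b\<close> in \<open>L\<close> extends to \<open>L\<close> by adding a multiple of
  \<open>\<phi> b\<close>, chosen to fit at one point \<open>y\<close> of \<open>L\<close> outside
  that kernel.\<close>

lemma functional_in_span_or_separated:
  fixes L :: "(complex ^ 'n::finite) set" and \<phi> :: "'b \<Rightarrow> complex ^ 'n \<Rightarrow> complex"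
  assumes "finite F" and "vec.subspace L"
    and "\<And>b. Vector_Spaces.linear (*s) (*) (\<phi> b)"
    and "Vector_Spaces.linear (*s) (*) \<psi>"
    and "\<And>x. x \<in> L \<Longrightarrow> (\<And>b. b \<in> F \<Longrightarrow> \<phi> b x = 0) \<Longrightarrow> \<psi> x = 0"
  shows "\<exists>a. \<forall>x\<in>L. \<psi> x = (\<Sum>b\<in>F. a b * \<phi> b x)"
  using assms(1,2,5)
proof (induction F arbitrary: L rule: finite_induct)
  case empty
  then show ?case by simp
next
  case (insert b F)
  interpret \<phi>: Vector_Spaces.linear "(*s)" "(*)" "\<phi> c" for c by (rule assms(3))
  interpret \<psi>: Vector_Spaces.linear "(*s)" "(*)" \<psi> by (rule assms(4))
  let ?L = "{x \<in> L. \<phi> b x = 0}"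
  have "vec.subspace ?L"
    using insert.prems(1) by (auto simp: vec.subspace_def \<phi>.add \<phi>.scale)
  from insert.IH[OF this] insert.prems(2)
  obtain a where a: "\<psi> x = (\<Sum>c\<in>F. a c * \<phi> c x)" if "x \<in> L" "\<phi> b x = 0" for x
    by auto
  show ?case
  proof (cases "\<forall>x\<in>L. \<phi> b x = 0")
    case True
    with a insert.hyps show ?thesis
      by (intro exI[of _ a]) simp
  next
    case False
    then obtain y where y: "y \<in> L" "\<phi> b y \<noteq> 0" by blast
    let ?a = "a(b := (\<psi> y - (\<Sum>c\<in>F. a c * \<phi> c y)) / \<phi> b y)"
    have "\<psi> x = (\<Sum>c\<in>insert b F. ?a c * \<phi> c x)" if x: "x \<in> L" for x
    proof -
      define t where "t = \<phi> b x / \<phi> b y"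
      have "x - t *s y \<in> L"
        using insert.prems(1) x y(1) by (intro vec.subspace_diff vec.subspace_scale)
      moreover have "\<phi> b (x - t *s y) = 0"
        using y(2) by (simp add: \<phi>.diff \<phi>.scale t_def)
      ultimately have "\<psi> (x - t *s y) = (\<Sum>c\<in>F. a c * \<phi> c (x - t *s y))"
        by (rule a)
      then have "\<psi> x = (\<Sum>c\<in>F. a c * \<phi> c x) + t * (\<psi> y - (\<Sum>c\<in>F. a c * \<phi> c y))"
        by (simp add: \<phi>.diff \<phi>.scale \<psi>.diff \<psi>.scale algebra_simps sum_subtractf sum_distrib_left)
      also have "(\<Sum>c\<in>F. a c * \<phi> c x) = (\<Sum>c\<in>F. ?a c * \<phi> c x)"
        using insert.hyps by (intro sum.cong) auto
      finally show ?thesis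
        using insert.hyps by (simp add: t_def)
    qed
    then show ?thesis by blast
  qed
qed

lemma linear_pairing: "Vector_Spaces.linear (*s) (*) (\<lambda>v. \<Sum>i\<in>UNIV. b $ i * (v :: complex ^ 'n::finite) $ i)"
  by unfold_locales (auto simp: algebra_simps sum.distrib sum_distrib_left)

lemma linear_coord: "Vector_Spaces.linear (*s) (*) (\<lambda>v. (v :: complex ^ 'n::finite) $ i)"
  by unfold_locales (auto simp: algebra_simps)

text \<open>For \<open>W\<close> the gradients of the equations at a point, this writes a hyperplane
  containing the tangent space as a finite combination of gradients.\<close>

lemma double_annihilator:
  fixes W :: "(complex ^ 'n::finite) set"
  assumes "\<And>v. \<forall>w\<in>W. (\<Sum>i\<in>UNIV. w $ i * v $ i) = 0 \<Longrightarrow> (\<Sum>i\<in>UNIV. z $ i * v $ i) = 0"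
  obtains B a where "finite B" "B \<subseteq> W" "z = (\<Sum>b\<in>B. a b *s b)"
proof -
  obtain B where B: "B \<subseteq> W" "vec.independent B" "W \<subseteq> vec.span B"
    by (rule vec.maximal_independent_subset)
  have fin: "finite B" by (rule vec.finiteI_independent[OF B(2)])
  have "(\<Sum>i\<in>UNIV. z $ i * v $ i) = 0" if v: "\<And>b. b \<in> B \<Longrightarrow> (\<Sum>i\<in>UNIV. b $ i * v $ i) = 0" for v
  proof (rule assms, rule ballI)
    fix w assume "w \<in> W"
    with B(3) have "w \<in> vec.span B" by blast
    then show "(\<Sum>i\<in>UNIV. w $ i * v $ i) = 0"
    proof (induction rule: vec.span_induct_alt)
      case (step c x y)
      then show ?case
        using v[of x] by (simp add: distrib_right sum.distrib mult.assoc flip: sum_distrib_left)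
    qed simp
  qed
  then obtain a where a: "(\<Sum>i\<in>UNIV. z $ i * v $ i) = (\<Sum>b\<in>B. a b * (\<Sum>i\<in>UNIV. b $ i * v $ i))" for v
    using functional_in_span_or_separated[OF fin vec.subspace_UNIV linear_pairing linear_pairing, of "\<lambda>b. b" z]
    by auto
  have "z $ j = (\<Sum>b\<in>B. a b *s b) $ j" for j
    using a[of "axis j 1"] by (simp add: axis_def if_distrib cong: if_cong)
  with fin B(1) show ?thesis by (intro that) (auto simp: vec_eq_iff)
qed

text \<open>Gaussian elimination replaces the determinant: \<open>\<phi>\<close> is a product of pivots, all equal to \<open>1\<close>
  at \<open>p\<close>.\<close>

lemma elimination_form:
  fixes A :: "'q \<Rightarrow> 'q \<Rightarrow> complex ^ 'n::finite \<Rightarrow> complex"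
  assumes "finite Q"
    and "\<And>r s. r \<in> Q \<Longrightarrow> s \<in> Q \<Longrightarrow> form k (A r s)"
    and "\<And>r s. r \<in> Q \<Longrightarrow> s \<in> Q \<Longrightarrow> A r s p = (if r = s then 1 else 0)"
  shows "\<exists>l \<phi>. form l \<phi> \<and> \<phi> p = 1 \<and>
    (\<forall>z v. (\<forall>r\<in>Q. (\<Sum>s\<in>Q. A r s z * v s) = 0) \<longrightarrow> (\<exists>s\<in>Q. v s \<noteq> 0) \<longrightarrow> \<phi> z = 0)"
  using assms
proof (induction Q arbitrary: A k rule: finite_induct)
  case empty
  show ?case by (intro exI[of _ 0] exI[of _ "\<lambda>x. 1"]) (simp add: form_const)
next
  case (insert b Q)
  \<comment> \<open>Fraction-free elimination of column \<open>b\<close>: without division, the new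
    entries are again forms, of degree \<open>k + k\<close>.\<close>
  define B where "B r s z = A b b z * A r s z + (-1) * (A r b z * A b s z)" for r s z
  have "form (k + k) (B r s)" if "r \<in> Q" "s \<in> Q" for r s
    unfolding B_def[abs_def]
    by (intro form_add form_cmult form_mult insert.prems(1)) (use that in auto)
  moreover have "B r s p = (if r = s then 1 else 0)" if "r \<in> Q" "s \<in> Q" for r s
    using that insert.hyps insert.prems(2)[of b b] insert.prems(2)[of r s] insert.prems(2)[of r b]
    by (auto simp: B_def)
  ultimately obtain l \<phi> where \<phi>: "form l \<phi>" "\<phi> p = 1"
    "\<And>z v. \<lbrakk>\<And>r. r \<in> Q \<Longrightarrow> (\<Sum>s\<in>Q. B r s z * v s) = 0; \<exists>s\<in>Q. v s \<noteq> 0\<rbrakk> \<Longrightarrow> \<phi> z = 0"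
    using insert.IH[of "k + k" B] by blast
  have "form (l + k) (\<lambda>z. \<phi> z * A b b z)"
    by (intro form_mult \<phi>(1) insert.prems(1)) auto
  moreover have "\<phi> p * A b b p = 1"
    using \<phi>(2) insert.prems(2)[of b b] by simp
  moreover have "\<phi> z * A b b z = 0"
    if ker: "\<forall>r\<in>insert b Q. (\<Sum>s\<in>insert b Q. A r s z * v s) = 0" and v: "\<exists>s\<in>insert b Q. v s \<noteq> 0"
    for z v
  proof (cases "\<exists>s\<in>Q. v s \<noteq> 0")
    case True
    have row: "(\<Sum>s\<in>Q. A r s z * v s) = - (A r b z * v b)" if "r \<in> insert b Q" for r
      using ker that insert.hyps by (auto simp: eq_neg_iff_add_eq_0 add.commute)
    have "(\<Sum>s\<in>Q. B r s z * v s) = 0" if "r \<in> Q" for r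
    proof -
      have "(\<Sum>s\<in>Q. B r s z * v s) =
          A b b z * (\<Sum>s\<in>Q. A r s z * v s) - A r b z * (\<Sum>s\<in>Q. A b s z * v s)"
        by (simp add: B_def algebra_simps sum_subtractf sum_distrib_left)
      then show ?thesis
        using row[of r] row[of b] that by simp
    qed
    then have "\<phi> z = 0" using True by (rule \<phi>(3))
    then show ?thesis by simp
  \<comment> \<open>Now \<open>v\<close> is supported at \<open>b\<close>, so row \<open>b\<close>
    forces the pivot \<open>A b b z\<close> to vanish.\<close>
  next
    case False
    then have "(\<Sum>s\<in>Q. A b s z * v s) = 0" by (intro sum.neutral) auto
    then have "A b b z * v b = 0" using ker insert.hyps by auto
    then show ?thesis using v False by auto
  qed
  ultimately show ?case by blast
qed

subsection \<open>Lattice points of a permutohedron\<close>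

text \<open>The entries may be any permutation of \<open>2, 6, 10, \<dots>\<close>, or anything majorized by these.\<close>

definition perm_points :: "('n::finite \<Rightarrow> nat) set" where
  "perm_points = {m. (\<forall>S. 2 * (card S)\<^sup>2 \<le> sum m S) \<and> sum m UNIV = 2 * (CARD('n))\<^sup>2}"

lemma finite_perm_points: "finite (perm_points :: ('n::finite \<Rightarrow> nat) set)"
proof -
  have "m i \<le> 2 * (CARD('n))\<^sup>2" if "m \<in> perm_points" for m :: "'n \<Rightarrow> nat" and i
    using that member_le_sum[of i UNIV m] by (simp add: perm_points_def)
  then have "(perm_points :: ('n \<Rightarrow> nat) set) \<subseteq> UNIV \<rightarrow>\<^sub>E {.. 2 * (CARD('n))\<^sup>2}"
    by auto
  then show ?thesis
    by (rule finite_subset) (intro finite_PiE; simp)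
qed

lemma perm_points_nonempty: "(\<lambda>i :: 'n::finite. 2 * CARD('n)) \<in> perm_points"
proof -
  have "card S * card S \<le> CARD('n) * card S" for S :: "'n set"
    by (intro mult_right_mono card_mono) auto
  then show ?thesis
    by (simp add: perm_points_def power2_eq_square algebra_simps)
qed

text \<open>By the inequality for singletons, the truncated subtraction in \<open>transfer\<close>
  is exact for amounts up to \<open>2\<close>.\<close>

lemma perm_points_ge_2: "m \<in> perm_points \<Longrightarrow> 2 \<le> m (i :: 'n::finite)"
  unfolding perm_points_def by (auto dest!: spec[of _ "{i}"])

definition transfer :: "nat \<Rightarrow> 'n \<Rightarrow> 'n \<Rightarrow> ('n \<Rightarrow> nat) \<Rightarrow> 'n \<Rightarrow> nat" where
  "transfer r a b m = m(a := m a - r, b := m b + r)"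

text \<open>If \<open>a \<in> S\<close> and \<open>b \<notin> S\<close>, then adding the inequalities for \<open>S - {a}\<close> and \<open>insert b S\<close>
  shows that the inequality for \<open>S\<close> holds with slack at least \<open>2\<close>.\<close>

lemma transfer_perm_points:
  fixes m :: "'n::finite \<Rightarrow> nat"
  assumes m: "m \<in> perm_points" and "a \<noteq> b" "m b \<le> m a" "r \<le> 2"
  shows "transfer r a b m \<in> perm_points"
proof -
  have ra: "r \<le> m a" using perm_points_ge_2[OF m, of a] assms(4) by simp
  have split: "sum f S = (if a \<in> S then f a else 0) + (if b \<in> S then f b else 0) + sum f (S - {a, b})"
    for f :: "'n \<Rightarrow> nat" and S
  proof -
    have "sum f S = (if a \<in> S then f a else 0) + sum f (S - {a})"
      by (simp add: sum.remove)
    also have "sum f (S - {a}) = (if b \<in> S then f b else 0) + sum f (S - {a} - {b})"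
      using \<open>a \<noteq> b\<close> by (simp add: sum.remove)
    also have "S - {a} - {b} = S - {a, b}" by blast
    finally show ?thesis by simp
  qed
  have rest: "sum (transfer r a b m) (S - {a, b}) = sum m (S - {a, b})" for S
    by (intro sum.cong) (auto simp: transfer_def)
  have "2 * (card S)\<^sup>2 \<le> sum (transfer r a b m) S" for S
  proof (cases "a \<in> S \<and> b \<notin> S")
    case True
    define s where "s = card (S - {a})"
    have s: "card S = Suc s" "card (insert b S) = s + 2"
      using True card.remove[of S a] by (auto simp: s_def)
    have "2 * s\<^sup>2 \<le> sum m (S - {a})" "2 * (s + 2)\<^sup>2 \<le> sum m (insert b S)"
      using m unfolding s(2)[symmetric] unfolding s_def by (simp_all add: perm_points_def del: card_insert_disjoint)
    moreover have "sum m S = m a + sum m (S - {a})" "sum m (insert b S) = m b + sum m S"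
      using True by (auto simp: sum.remove)
    \<comment> \<open>Since \<open>m b \<le> m a\<close>, the two right-hand sides add up to at most
      \<open>2 * sum m S\<close>, while \<open>2 * s\<^sup>2 + 2 * (s + 2)\<^sup>2 = 4 * (s +
      1)\<^sup>2 + 4\<close>.\<close>
    ultimately have "2 * (card S)\<^sup>2 + r \<le> sum m S"
      using assms(3,4) s(1) by (simp add: power2_eq_square algebra_simps)
    also have "sum m S = sum (transfer r a b m) S + r"
      using True ra \<open>a \<noteq> b\<close> unfolding split[of m S] split[of "transfer r a b m" S] rest
      by (simp add: transfer_def)
    finally show ?thesis by simp
  next
    case False
    have "2 * (card S)\<^sup>2 \<le> sum m S" using m by (simp add: perm_points_def)
    also have "\<dots> \<le> sum (transfer r a b m) S"
      using False ra \<open>a \<noteq> b\<close> unfolding split[of m S] split[of "transfer r a b m" S] rest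
      by (auto simp: transfer_def)
    finally show ?thesis .
  qed
  moreover have "sum (transfer r a b m) UNIV = sum m UNIV"
    using ra \<open>a \<noteq> b\<close> unfolding split[of m UNIV] split[of "transfer r a b m" UNIV] rest
    by (simp add: transfer_def)
  ultimately show ?thesis
    using m by (simp add: perm_points_def)
qed

text \<open>Exponents are plain functions here because \<open>transfer\<close> is a function
  update.\<close>

definition power_monom :: "('n::finite \<Rightarrow> nat) \<Rightarrow> complex ^ 'n \<Rightarrow> complex" where
  "power_monom m x = (\<Prod>i\<in>UNIV. x $ i ^ m i)"

lemma power_monom_transfer:
  fixes m :: "'n::finite \<Rightarrow> nat"
  assumes "a \<noteq> b" "r \<le> m a"
  shows "power_monom (transfer r a b m) x * x $ a ^ r = power_monom m x * x $ b ^ r"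
proof -
  have split: "power_monom f x = x $ a ^ f a * (x $ b ^ f b * (\<Prod>i\<in>UNIV - {a} - {b}. x $ i ^ f i))" for f
    unfolding power_monom_def using \<open>a \<noteq> b\<close>
    by (subst prod.remove[of UNIV a]; simp) (subst prod.remove[of _ b]; simp)
  have "(\<Prod>i\<in>UNIV - {a} - {b}. x $ i ^ transfer r a b m i) = (\<Prod>i\<in>UNIV - {a} - {b}. x $ i ^ m i)"
    by (intro prod.cong) (auto simp: transfer_def)
  moreover have "x $ a ^ m a = x $ a ^ (m a - r) * x $ a ^ r"
    using assms(2) by (simp flip: power_add)
  ultimately show ?thesis
    using assms unfolding split[of m] split[of "transfer r a b m"]
    by (simp add: transfer_def power_add ac_simps)
qed

subsection \<open>Hyperplanes tangent to the reciprocal linear space along the torus\<close>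

text \<open>\<open>tangent_at L x\<close> is the conormal space of \<open>L\<^sup>-\<^sup>1\<close> at the coordinatewise inverse of \<open>x\<close>.\<close>

definition tangent_at :: "(complex ^ 'n::finite) set \<Rightarrow> complex ^ 'n \<Rightarrow> (complex ^ 'n) set" where
  "tangent_at L x = {z. \<forall>l\<in>L. (\<Sum>j\<in>UNIV. l $ j * z $ j / (x $ j)\<^sup>2) = 0}"

text \<open>The alternatives say whether \<open>i\<close> lies outside or inside the closure of
  \<open>F\<close> in the matroid of the coordinate functions on \<open>L\<close>.\<close>

lemma coord_separated_or_combination:
  fixes L :: "(complex ^ 'n::finite) set"
  assumes "vec.subspace L"
  obtains l where "l \<in> L" "l $ i = 1" "\<And>c. c \<in> F \<Longrightarrow> l $ c = 0"
  | a where "\<And>x. x \<in> L \<Longrightarrow> x $ i = (\<Sum>c\<in>F. a c * x $ c)"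
proof (cases "\<exists>l\<in>L. l $ i \<noteq> 0 \<and> (\<forall>c\<in>F. l $ c = 0)")
  case True
  then obtain l where l: "l \<in> L" "l $ i \<noteq> 0" "\<And>c. c \<in> F \<Longrightarrow> l $ c = 0" by blast
  show ?thesis
    by (rule that(1)[of "(1 / l $ i) *s l"]) (use l vec.subspace_scale[OF assms] in auto)
next
  case False
  then show ?thesis
    using functional_in_span_or_separated[OF _ assms linear_coord linear_coord, of F "\<lambda>c. c" i] that(2)
    by auto
qed

text \<open>The coefficients \<open>N\<close> depend on neither \<open>x\<close> nor
  \<open>z\<close>. The relations for all \<open>m\<close> in \<open>perm_points\<close> thus form a
  square linear system in the monomials of \<open>x\<close>, with linear forms in \<open>z\<close>
  as entries.\<close>

definition integral_relation ::
    "(complex ^ 'n::finite) set \<Rightarrow> 'n \<Rightarrow> ('n \<Rightarrow> nat) \<Rightarrow> ('n \<Rightarrow> ('n \<Rightarrow> nat) \<Rightarrow> complex) \<Rightarrow> bool" where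
  "integral_relation L i m N \<longleftrightarrow> (\<forall>x\<in>L \<inter> torus. \<forall>z\<in>tangent_at L x.
    z $ i * power_monom m x = (\<Sum>j\<in>UNIV - {i}. z $ j * (\<Sum>m'\<in>perm_points. N j m' * power_monom m' x)))"

lemma integral_relationD:
  "integral_relation L i m N \<Longrightarrow> x \<in> L \<inter> torus \<Longrightarrow> z \<in> tangent_at L x \<Longrightarrow>
    z $ i * power_monom m x = (\<Sum>j\<in>UNIV - {i}. z $ j * (\<Sum>m'\<in>perm_points. N j m' * power_monom m' x))"
  by (simp add: integral_relation_def)

text \<open>Induction on \<open>m i\<close>. Let \<open>F\<close> be the set of coordinates with smaller exponent. If some \<open>l \<in> L\<close> with
  \<open>l $ i = 1\<close> vanishes on \<open>F\<close>, the tangency relation for \<open>l\<close>, multiplied by the monomial of \<open>m\<close> and by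
  \<open>(x $ i)\<^sup>2\<close>, expresses the product through exponents \<open>transfer 2 j i m\<close> with \<open>m i \<le> m j\<close>. Otherwise
  \<open>x $ i\<close> is on \<open>L\<close> a combination of the \<open>x $ c\<close> with \<open>c \<in> F\<close>, and substituting it for one factor \<open>x $ i\<close>
  lowers \<open>m i\<close>.\<close>

lemma integral_relation_exists:
  fixes L :: "(complex ^ 'n::finite) set" and i :: 'n
  assumes L: "vec.subspace L" and loopless: "\<not> L \<subseteq> {x. x $ i = 0}"
    and "m \<in> perm_points"
  shows "\<exists>N. integral_relation L i m N"
  using assms(3)
proof (induction "m i" arbitrary: m rule: less_induct)
  case less
  define F where "F = {c. m c < m i}"
  show ?case
  proof (rule coord_separated_or_combination[OF L, of i F])
    fix l assume l: "l \<in> L" "l $ i = 1" "\<And>c. c \<in> F \<Longrightarrow> l $ c = 0"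
    define N where "N j m' = (if m' = transfer 2 j i m then - l $ j else 0)" for j m'
    have "z $ i * power_monom m x = (\<Sum>j\<in>UNIV - {i}. z $ j * (\<Sum>m'\<in>perm_points. N j m' * power_monom m' x))"
      if x: "x \<in> L \<inter> torus" and z: "z \<in> tangent_at L x" for x z
    proof -
      have nz: "x $ j \<noteq> 0" for j using x by (simp add: torus_def)
      have "0 = (\<Sum>j\<in>UNIV. l $ j * z $ j / (x $ j)\<^sup>2)"
        using z l(1) by (simp add: tangent_at_def)
      also have "\<dots> = z $ i / (x $ i)\<^sup>2 + (\<Sum>j\<in>UNIV - {i}. l $ j * z $ j / (x $ j)\<^sup>2)"
        using l(2) by (simp add: sum.remove[of UNIV i])
      finally have zi: "z $ i / (x $ i)\<^sup>2 = (\<Sum>j\<in>UNIV - {i}. - l $ j * z $ j / (x $ j)\<^sup>2)"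
        by (simp add: sum_negf eq_neg_iff_add_eq_0)
      have "z $ i * power_monom m x = power_monom m x * (x $ i)\<^sup>2 * (z $ i / (x $ i)\<^sup>2)"
        using nz by simp
      also have "\<dots> = (\<Sum>j\<in>UNIV - {i}. power_monom m x * (x $ i)\<^sup>2 * (- l $ j * z $ j / (x $ j)\<^sup>2))"
        by (simp only: zi sum_distrib_left)
      also have "\<dots> = (\<Sum>j\<in>UNIV - {i}. z $ j * (\<Sum>m'\<in>perm_points. N j m' * power_monom m' x))"
      proof (rule sum.cong[OF refl])
        fix j assume j: "j \<in> UNIV - {i}"
        show "power_monom m x * (x $ i)\<^sup>2 * (- l $ j * z $ j / (x $ j)\<^sup>2) =
            z $ j * (\<Sum>m'\<in>perm_points. N j m' * power_monom m' x)"
        proof (cases "j \<in> F")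
          \<comment> \<open>Here the transfer may leave \<open>perm_points\<close>, but
            \<open>l $ j = 0\<close> kills both sides.\<close>
          case True
          then have "N j m' = 0" for m' using l(3) by (simp add: N_def)
          with True show ?thesis using l(3) by simp
        next
          case False
          then have "transfer 2 j i m \<in> perm_points"
            using less.prems j by (intro transfer_perm_points) (auto simp: F_def)
          then have "(\<Sum>m'\<in>perm_points. N j m' * power_monom m' x) = - l $ j * power_monom (transfer 2 j i m) x"
            by (simp add: N_def if_distrib[of "\<lambda>t. t * _"] finite_perm_points cong: if_cong)
          moreover have "power_monom (transfer 2 j i m) x * (x $ j)\<^sup>2 = power_monom m x * (x $ i)\<^sup>2"
            using j perm_points_ge_2[OF less.prems] by (intro power_monom_transfer) auto
          ultimately show ?thesis
            using nz[of j] by (simp add: field_simps)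
        qed
      qed
      finally show ?thesis .
    qed
    then have "integral_relation L i m N" by (simp add: integral_relation_def)
    then show ?thesis by blast
  next
    fix a assume a: "\<And>x. x \<in> L \<Longrightarrow> x $ i = (\<Sum>c\<in>F. a c * x $ c)"
    have "\<exists>N. integral_relation L i (transfer 1 i c m) N" if "c \<in> F" for c
    proof (rule less.hyps)
      have c: "c \<noteq> i" "m c < m i" using that by (auto simp: F_def)
      then show "transfer 1 i c m i < m i" by (simp add: transfer_def)
      show "transfer 1 i c m \<in> perm_points"
        using c by (intro transfer_perm_points less.prems) auto
    qed
    then obtain N where N: "\<And>c. c \<in> F \<Longrightarrow> integral_relation L i (transfer 1 i c m) (N c)"
      by metis
    define N' where "N' j m' = (\<Sum>c\<in>F. a c * N c j m')" for j m'
    have "z $ i * power_monom m x = (\<Sum>j\<in>UNIV - {i}. z $ j * (\<Sum>m'\<in>perm_points. N' j m' * power_monom m' x))"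
      if x: "x \<in> L \<inter> torus" and z: "z \<in> tangent_at L x" for x z
    proof -
      have nz: "x $ i \<noteq> 0" using x by (simp add: torus_def)
      have "power_monom (transfer 1 i c m) x * x $ i = power_monom m x * x $ c" if "c \<in> F" for c
        using power_monom_transfer[of i c 1 m x] perm_points_ge_2[OF less.prems, of i] that
        by (auto simp: F_def)
      then have "(\<Sum>c\<in>F. a c * power_monom (transfer 1 i c m) x) * x $ i = (\<Sum>c\<in>F. a c * (power_monom m x * x $ c))"
        by (simp add: sum_distrib_right mult.assoc)
      also have "\<dots> = power_monom m x * (\<Sum>c\<in>F. a c * x $ c)"
        by (simp add: sum_distrib_left ac_simps)
      also have "\<dots> = power_monom m x * x $ i"
        using a[of x] x by simp
      finally have "power_monom m x = (\<Sum>c\<in>F. a c * power_monom (transfer 1 i c m) x)"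
        using nz by simp
      then have "z $ i * power_monom m x = (\<Sum>c\<in>F. a c * (z $ i * power_monom (transfer 1 i c m) x))"
        by (simp add: sum_distrib_left ac_simps)
      also have "\<dots> = (\<Sum>c\<in>F. a c * (\<Sum>j\<in>UNIV - {i}. z $ j * (\<Sum>m'\<in>perm_points. N c j m' * power_monom m' x)))"
        by (intro sum.cong refl) (simp only: integral_relationD[OF N x z])
      also have "\<dots> = (\<Sum>j\<in>UNIV - {i}. \<Sum>c\<in>F. a c * (z $ j * (\<Sum>m'\<in>perm_points. N c j m' * power_monom m' x)))"
        unfolding sum_distrib_left by (rule sum.swap)
      also have "\<dots> = (\<Sum>j\<in>UNIV - {i}. z $ j * (\<Sum>m'\<in>perm_points. N' j m' * power_monom m' x))"
      proof (rule sum.cong[OF refl])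
        fix j
        have "(\<Sum>m'\<in>perm_points. N' j m' * power_monom m' x) =
            (\<Sum>c\<in>F. a c * (\<Sum>m'\<in>perm_points. N c j m' * power_monom m' x))"
          unfolding N'_def sum_distrib_left sum_distrib_right
          by (subst sum.swap) (simp add: ac_simps)
        then show "(\<Sum>c\<in>F. a c * (z $ j * (\<Sum>m'\<in>perm_points. N c j m' * power_monom m' x))) =
            z $ j * (\<Sum>m'\<in>perm_points. N' j m' * power_monom m' x)"
          by (simp add: sum_distrib_left ac_simps)
      qed
      finally show ?thesis .
    qed
    then have "integral_relation L i m N'" by (simp add: integral_relation_def)
    then show ?thesis by blast
  qed
qed

lemma tangent_form_exists:
  fixes L :: "(complex ^ 'n::finite) set" and i :: 'n
  assumes "vec.subspace L" and "\<not> L \<subseteq> {x. x $ i = 0}"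
  obtains k \<phi> where "form k \<phi>" "\<phi> (axis i 1) = 1"
    "\<And>x z. x \<in> L \<inter> torus \<Longrightarrow> z \<in> tangent_at L x \<Longrightarrow> \<phi> z = 0"
proof -
  obtain N where N: "\<And>m. m \<in> perm_points \<Longrightarrow> integral_relation L i m (N m)"
    using integral_relation_exists[OF assms] by metis
  \<comment> \<open>The matrix of the system, \<open>z $ i\<close> times the identity minus the sum
    of \<open>z $ j\<close> times the matrix of the \<open>N r j s\<close>. It is the identity at
    \<open>axis i 1\<close>, and the monomials of \<open>x\<close> form a kernel vector, nonzero on
    the torus.\<close>
  define A where "A r s z = (if r = s then 1 else 0) * z $ i + (\<Sum>j\<in>UNIV - {i}. (- N r j s) * z $ j)"
    for r s and z :: "complex ^ 'n"
  have "form 1 (A r s)" for r s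
    unfolding A_def[abs_def] by (intro form_add form_sum form_cmult form_coord)
  moreover have "A r s (axis i 1) = (if r = s then 1 else 0)" for r s
    by (simp add: A_def axis_def)
  ultimately obtain k \<phi> where \<phi>: "form k \<phi>" "\<phi> (axis i 1) = 1"
    "\<forall>z v. (\<forall>r\<in>perm_points. (\<Sum>s\<in>perm_points. A r s z * v s) = 0) \<longrightarrow>
      (\<exists>s\<in>perm_points. v s \<noteq> 0) \<longrightarrow> \<phi> z = 0"
    using elimination_form[OF finite_perm_points, of 1 A "axis i 1"] by auto
  have "\<phi> z = 0" if x: "x \<in> L \<inter> torus" and z: "z \<in> tangent_at L x" for x z
  proof (rule \<phi>(3)[rule_format, where v = "\<lambda>m. power_monom m x", rotated])
    have "power_monom m x \<noteq> 0" for m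
      using x by (auto simp: power_monom_def torus_def)
    then show "\<exists>s\<in>perm_points. power_monom s x \<noteq> 0"
      using perm_points_nonempty by blast
    have "(\<Sum>s\<in>perm_points. A r s z * power_monom s x) = 0" if r: "r \<in> perm_points" for r
    proof -
      have "(\<Sum>s\<in>perm_points. A r s z * power_monom s x) =
          (\<Sum>s\<in>perm_points. (if r = s then 1 else 0) * z $ i * power_monom s x) -
          (\<Sum>s\<in>perm_points. \<Sum>j\<in>UNIV - {i}. z $ j * (N r j s * power_monom s x))"
        unfolding sum_subtractf[symmetric]
        by (intro sum.cong refl) (auto simp: A_def algebra_simps sum_distrib_left sum_negf)
      also have "(\<Sum>s\<in>perm_points. (if r = s then 1 else 0) * z $ i * power_monom s x) = z $ i * power_monom r x"
        using r by (simp add: if_distrib[of "\<lambda>t. t * _"] finite_perm_points cong: if_cong)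
      also have "(\<Sum>s\<in>perm_points. \<Sum>j\<in>UNIV - {i}. z $ j * (N r j s * power_monom s x)) =
          (\<Sum>j\<in>UNIV - {i}. z $ j * (\<Sum>s\<in>perm_points. N r j s * power_monom s x))"
        by (subst sum.swap) (simp add: sum_distrib_left)
      finally show ?thesis using integral_relationD[OF N[OF r] x z] by simp
    qed
    then show "\<And>r. r \<in> perm_points \<Longrightarrow> (\<Sum>s\<in>perm_points. A r s z * power_monom s x) = 0" .
  qed
  with \<phi>(1,2) show ?thesis by (rule that)
qed

subsection \<open>The dual variety\<close>

definition reciprocal_points :: "(complex ^ 'n::finite) set \<Rightarrow> (complex ^ 'n) set" where
  "reciprocal_points L = (\<lambda>x. \<chi> i. inverse (x $ i)) ` (L \<inter> torus)"

lemma form_vanishing_on_closure: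
  assumes "form k \<phi>" and "\<And>x. x \<in> S \<Longrightarrow> \<phi> x = 0" and "x \<in> zariski_closure S"
  shows "\<phi> x = 0"
proof -
  obtain f where f: "homogeneous k f" "eval_cpoly f = \<phi>"
    using assms(1) by (auto simp: form_def)
  then have "f \<in> vanishing_forms S"
    using assms(2) by (auto simp: vanishing_forms_def)
  then show ?thesis
    using assms(3) f(2) by (auto simp: zariski_closure_def proj_zeros_def)
qed

lemma vanishing_forms_zariski_closure:
  assumes "f \<in> vanishing_forms (zariski_closure S)" and "x \<in> S" and "x \<noteq> 0"
  shows "eval_cpoly f x = 0"
proof -
  have "x \<in> zariski_closure S"
    using assms(2,3) by (auto simp: zariski_closure_def proj_zeros_def vanishing_forms_def)
  then show ?thesis
    using assms(1) by (simp add: vanishing_forms_def)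
qed

section \<open>Gradients of the equations as conormal vectors\<close>

definition gradient :: "'n::finite cpoly \<Rightarrow> complex ^ 'n \<Rightarrow> complex ^ 'n" where
  "gradient f x = (\<chi> i. eval_cpoly (partial_deriv i f) x)"

text \<open>For \<open>l\<close> in \<open>L\<close>, the inverse of \<open>x + t *s l\<close> is a
  curve in the reciprocal points for small \<open>t\<close>, with velocity
  \<open>- l $ j / (x $ j)\<^sup>2\<close> at \<open>t = 0\<close>. As \<open>f\<close> vanishes
  along it, the chain rule gives the relation.\<close>

lemma gradient_in_tangent_at:
  fixes L :: "(complex ^ 'n::finite) set"
  assumes L: "vec.subspace L" and x: "x \<in> L \<inter> torus"
    and f: "\<And>u. u \<in> reciprocal_points L \<Longrightarrow> eval_cpoly f u = 0"
  shows "gradient f (\<chi> i. inverse (x $ i)) \<in> tangent_at L x"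
  unfolding tangent_at_def
proof (intro CollectI ballI)
  fix l assume l: "l \<in> L"
  define u where "u t = (\<chi> i. inverse (x $ i + t * l $ i))" for t
  have nz: "x $ j \<noteq> 0" for j using x by (simp add: torus_def)
  have "((\<lambda>t. u t $ j) has_field_derivative - (l $ j / (x $ j)\<^sup>2)) (at 0)" for j
    unfolding u_def using nz[of j]
    by (auto intro!: derivative_eq_intros simp: power2_eq_square divide_simps)
  then have "((\<lambda>t. eval_cpoly f (u t)) has_field_derivative
      (\<Sum>i\<in>UNIV. eval_cpoly (partial_deriv i f) (u 0) * - (l $ i / (x $ i)\<^sup>2))) (at 0)"
    by (rule eval_cpoly_has_derivative)
  moreover have "((\<lambda>t. eval_cpoly f (u t)) has_field_derivative 0) (at 0)"
  proof (rule has_field_derivative_transform_within_open[where f = "\<lambda>t. 0"])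
    let ?S = "\<Inter>j\<in>UNIV. {t. x $ j + t * l $ j \<noteq> 0}"
    show "open ?S"
      by (intro open_INT finite ballI open_Collect_neq continuous_intros)
    show "0 \<in> ?S" using nz by simp
    fix t assume "t \<in> ?S"
    moreover have "x + t *s l \<in> L"
      using x l L by (intro vec.subspace_add vec.subspace_scale) auto
    ultimately have "x + t *s l \<in> L \<inter> torus" by (simp add: torus_def)
    then have "u t \<in> reciprocal_points L"
      unfolding reciprocal_points_def by (rule rev_image_eqI) (simp add: u_def)
    then show "0 = eval_cpoly f (u t)" by (simp add: f)
  qed simp
  ultimately have "(\<Sum>i\<in>UNIV. eval_cpoly (partial_deriv i f) (u 0) * - (l $ i / (x $ i)\<^sup>2)) = 0"
    by (rule DERIV_unique)
  then show "(\<Sum>j\<in>UNIV. l $ j * gradient f (\<chi> i. inverse (x $ i)) $ j / (x $ j)\<^sup>2) = 0"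
    by (simp add: gradient_def u_def sum_negf ac_simps)
qed

lemma tangent_at_combination:
  assumes "\<And>b. b \<in> B \<Longrightarrow> g b \<in> tangent_at L x"
  shows "(\<Sum>b\<in>B. a b *s g b) \<in> tangent_at L x"
  unfolding tangent_at_def
proof (intro CollectI ballI)
  fix l assume l: "l \<in> L"
  have "(\<Sum>j\<in>UNIV. l $ j * (\<Sum>b\<in>B. a b *s g b) $ j / (x $ j)\<^sup>2) =
      (\<Sum>b\<in>B. a b * (\<Sum>j\<in>UNIV. l $ j * g b $ j / (x $ j)\<^sup>2))"
    unfolding sum_distrib_left
    by (subst sum.swap) (simp add: sum_distrib_left sum_divide_distrib ac_simps)
  also have "\<dots> = 0"
    using assms l by (intro sum.neutral) (auto simp: tangent_at_def)
  finally show "(\<Sum>j\<in>UNIV. l $ j * (\<Sum>b\<in>B. a b *s g b) $ j / (x $ j)\<^sup>2) = 0" .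
qed

text \<open>A conormal vector at an arbitrary point \<open>y\<close> of \<open>L\<^sup>-\<^sup>1\<close> is a combination of gradients at \<open>y\<close>. The
  same combination of gradients, with coefficients made homogeneous by powers of a coordinate \<open>x $ s\<close>
  with \<open>y $ s \<noteq> 0\<close>, is conormal at all points of the torus part, so \<open>\<phi>\<close> vanishes on it there, and
  hence also at \<open>y\<close>.\<close>

lemma form_vanishing_on_conormal:
  fixes L :: "(complex ^ 'n::finite) set"
  assumes L: "vec.subspace L" and \<phi>: "form k \<phi>"
    and van: "\<And>x z. x \<in> L \<inter> torus \<Longrightarrow> z \<in> tangent_at L x \<Longrightarrow> \<phi> z = 0"
    and y: "y \<in> reciprocal_linear_space L"
    and z: "tangent_space (reciprocal_linear_space L) y \<subseteq> hyperplane z"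
  shows "\<phi> z = 0"
proof -
  let ?V = "vanishing_forms (reciprocal_linear_space L)"
  have X: "reciprocal_linear_space L = zariski_closure (reciprocal_points L)"
    by (simp add: reciprocal_linear_space_def reciprocal_points_def)
  have "y \<noteq> 0" using y by (simp add: X zariski_closure_def proj_zeros_def)
  then obtain s where s: "y $ s \<noteq> 0" by (auto simp: vec_eq_iff)
  have "(\<Sum>i\<in>UNIV. z $ i * v $ i) = 0"
    if "\<forall>w\<in>(\<lambda>f. gradient f y) ` ?V. (\<Sum>i\<in>UNIV. w $ i * v $ i) = 0" for v
  proof -
    have "v \<in> tangent_space (reciprocal_linear_space L) y"
      using that by (auto simp: tangent_space_def gradient_def)
    then show ?thesis using z by (auto simp: hyperplane_def)
  qed
  then obtain B a where B: "finite B" "B \<subseteq> (\<lambda>f. gradient f y) ` ?V" "z = (\<Sum>b\<in>B. a b *s b)"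
    by (rule double_annihilator)
  have "\<exists>f\<in>?V. b = gradient f y" if "b \<in> B" for b
    using that B(2) by blast
  then obtain f where f: "\<And>b. b \<in> B \<Longrightarrow> f b \<in> ?V" "\<And>b. b \<in> B \<Longrightarrow> b = gradient (f b) y"
    by metis
  have "\<exists>e. homogeneous e (f b)" if "b \<in> B" for b
    using f(1)[OF that] by (simp add: vanishing_forms_def)
  then obtain e where e: "\<And>b. b \<in> B \<Longrightarrow> homogeneous (e b) (f b)"
    by metis
  \<comment> \<open>A common bound for the degrees of all the gradients.\<close>
  define R where "R = sum e B"
  \<comment> \<open>Dividing by the power of \<open>y $ s\<close> gives \<open>c b y = a b\<close>,
    hence \<open>\<zeta> y = z\<close>.\<close>
  define c where "c b x = a b / y $ s ^ (R - (e b - 1)) * x $ s ^ (R - (e b - 1))" for b x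
  define \<zeta> where "\<zeta> x = (\<Sum>b\<in>B. c b x *s gradient (f b) x)" for x
  have "form R (\<lambda>x. \<zeta> x $ j)" for j
  proof -
    have "form R (\<lambda>x. \<Sum>b\<in>B. a b / y $ s ^ (R - (e b - 1)) *
        (x $ s ^ (R - (e b - 1)) * eval_cpoly (partial_deriv j (f b)) x))"
    proof (intro form_sum form_cmult)
      fix b assume b: "b \<in> B"
      have "e b \<le> R" using b B(1) by (simp add: R_def member_le_sum)
      then have "(R - (e b - 1)) * 1 + (e b - 1) = R" by simp
      then show "form R (\<lambda>x. x $ s ^ (R - (e b - 1)) * eval_cpoly (partial_deriv j (f b)) x)"
        using form_mult[OF form_power[OF form_coord] form_partial_deriv[OF e[OF b]],
            of "R - (e b - 1)" s j] by simp
    qed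
    then show ?thesis
      by (simp add: \<zeta>_def c_def gradient_def mult.assoc)
  qed
  with \<phi> have "form (k * R) (\<lambda>x. \<phi> (\<zeta> x))" by (rule form_compose)
  moreover have "\<phi> (\<zeta> u) = 0" if u: "u \<in> reciprocal_points L" for u
  proof -
    obtain x where x: "x \<in> L \<inter> torus" "u = (\<chi> i. inverse (x $ i))"
      using u by (auto simp: reciprocal_points_def)
    have "gradient (f b) u \<in> tangent_at L x" if b: "b \<in> B" for b
      unfolding x(2)
    proof (rule gradient_in_tangent_at[OF L x(1)])
      fix v assume v: "v \<in> reciprocal_points L"
      then have "v \<noteq> 0" by (auto simp: reciprocal_points_def torus_def vec_eq_iff)
      with v show "eval_cpoly (f b) v = 0"
        using f(1)[OF b] vanishing_forms_zariski_closure unfolding X by blast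
    qed
    then have "\<zeta> u \<in> tangent_at L x"
      unfolding \<zeta>_def by (rule tangent_at_combination)
    with x(1) show ?thesis by (rule van)
  qed
  ultimately have "\<phi> (\<zeta> y) = 0"
    using y unfolding X by (rule form_vanishing_on_closure)
  moreover have "\<zeta> y = z"
    unfolding \<zeta>_def B(3)
  proof (rule sum.cong[OF refl])
    fix b assume "b \<in> B"
    then show "c b y *s gradient (f b) y = a b *s b"
      using s f(2)[of b] by (simp add: c_def)
  qed
  ultimately show ?thesis by simp
qed

lemma axis_notin_discriminant_variety:
  fixes L :: "(complex ^ 'n::finite) set"
  assumes "vec.subspace L" and "\<not> L \<subseteq> {x. x $ i = 0}"
  shows "axis i 1 \<notin> matroid_discriminant_variety L"
proof
  assume mem: "axis i 1 \<in> matroid_discriminant_variety L"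
  obtain k \<phi> where \<phi>: "form k \<phi>" "\<phi> (axis i 1) = 1"
    "\<And>x z. x \<in> L \<inter> torus \<Longrightarrow> z \<in> tangent_at L x \<Longrightarrow> \<phi> z = 0"
    using tangent_form_exists[OF assms] by blast
  have "\<phi> (axis i 1) = 0"
    by (rule form_vanishing_on_closure[OF \<phi>(1) _ mem[unfolded matroid_discriminant_variety_def dual_variety_def]])
       (use form_vanishing_on_conormal[OF assms(1) \<phi>(1,3)] in \<open>auto simp: smooth_point_def\<close>)
  with \<phi>(2) show False by simp
qed

subsection \<open>Newton polytopes\<close>

lemma monom_fun_axis:
  "monom_fun m (axis i 1) = (if \<forall>j. j \<noteq> i \<longrightarrow> Poly_Mapping.lookup m j = 0 then 1 else 0)"
  by (auto simp: monom_fun_def axis_def power_0_left intro!: prod.neutral)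

text \<open>At a coordinate point only pure powers of that coordinate survive, and homogeneity fixes
  the exponent.\<close>

lemma axis_exponent_in_keys:
  assumes "homogeneous k f" and "eval_cpoly f (axis i 1) \<noteq> 0"
  shows "Poly_Mapping.single i k \<in> Poly_Mapping.keys f"
proof -
  obtain m where m: "m \<in> Poly_Mapping.keys f" "monom_fun m (axis i 1) \<noteq> 0"
    using assms(2) unfolding eval_cpoly_monom_fun by (rule sum.not_neutral_contains_not_neutral) auto
  then have m0: "Poly_Mapping.lookup m j = 0" if "j \<noteq> i" for j
    using that by (auto simp: monom_fun_axis split: if_splits)
  have "k = (\<Sum>j\<in>UNIV. Poly_Mapping.lookup m j)"
    using assms(1) m(1) by (simp add: homogeneous_def)
  also have "\<dots> = Poly_Mapping.lookup m i"
    using m0 by (subst sum.remove[of UNIV i]) auto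
  finally have "m = Poly_Mapping.single i k"
    using m0 by (intro poly_mapping_eqI) (auto simp: lookup_single when_def)
  with m(1) show ?thesis by simp
qed

lemma newton_polytope_eq_dilated_simplex:
  fixes f :: "'n::finite cpoly"
  assumes hom: "homogeneous k f" and "k > 0"
    and key: "\<And>i. Poly_Mapping.single i k \<in> Poly_Mapping.keys f"
  shows "newton_polytope f = (\<lambda>x. real k *\<^sub>R x) ` standard_simplex"
proof -
  let ?v = "\<lambda>m. (\<chi> i. real (Poly_Mapping.lookup m i)) :: real ^ 'n"
  let ?A = "range (\<lambda>i. real k *\<^sub>R axis i 1) :: (real ^ 'n) set"
  have "real k *\<^sub>R axis i 1 = ?v (Poly_Mapping.single i k)" for i
    by (auto simp: vec_eq_iff axis_def lookup_single when_def)
  then have "?A \<subseteq> ?v ` Poly_Mapping.keys f"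
    by (intro image_subsetI rev_image_eqI[OF key])
  then have "convex hull ?A \<subseteq> newton_polytope f"
    unfolding newton_polytope_def by (rule hull_mono)
  moreover have "newton_polytope f \<subseteq> convex hull ?A"
    unfolding newton_polytope_def
  proof (intro hull_minimal image_subsetI convex_convex_hull)
    fix m assume "m \<in> Poly_Mapping.keys f"
    then have "(\<Sum>i\<in>UNIV. Poly_Mapping.lookup m i) = k"
      using hom by (simp add: homogeneous_def)
    then have "(\<Sum>i\<in>UNIV. real (Poly_Mapping.lookup m i) / real k) = 1"
      using \<open>k > 0\<close> by (simp flip: sum_divide_distrib of_nat_sum)
    \<comment> \<open>The barycentric coordinates of an exponent vector are its entries divided by
      the degree.\<close>
    then have "(\<Sum>i\<in>UNIV. (real (Poly_Mapping.lookup m i) / real k) *\<^sub>R (real k *\<^sub>R axis i 1))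
        \<in> convex hull ?A"
      by (intro convex_sum) (auto intro: hull_inc)
    also have "(\<Sum>i\<in>UNIV. (real (Poly_Mapping.lookup m i) / real k) *\<^sub>R (real k *\<^sub>R axis i 1)) = ?v m"
      using \<open>k > 0\<close> by (simp add: vec_eq_iff axis_def if_distrib cong: if_cong)
    finally show "?v m \<in> convex hull ?A" .
  qed
  moreover have "(\<lambda>x. real k *\<^sub>R x) ` standard_simplex = convex hull ?A"
    by (simp add: standard_simplex_def image_image flip: convex_hull_scaling)
  ultimately show ?thesis by blast
qed

text \<open>A form of degree \<open>0\<close> is a constant, hence a unit if nonzero; so irreducible
  forms have positive degree.\<close>

lemma homogeneous_zero_dvd_one:
  fixes f :: "'n::finite cpoly"
  assumes "homogeneous 0 f" and "f \<noteq> 0"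
  shows "f dvd 1"
proof -
  define c where "c = Poly_Mapping.lookup f 0"
  have "m = 0" if "m \<in> Poly_Mapping.keys f" for m
    using assms(1) that by (intro poly_mapping_eqI) (auto simp: homogeneous_def)
  then have "Poly_Mapping.lookup f m = (if m = 0 then c else 0)" for m
    by (auto simp: c_def in_keys_iff)
  then have f: "f = Poly_Mapping.single 0 c"
    by (intro poly_mapping_eqI) (simp add: lookup_single when_def)
  with assms(2) have "c \<noteq> 0" by auto
  then have "1 = f * Poly_Mapping.single 0 (inverse c)"
    by (simp add: f mult_single)
  then show ?thesis by (rule dvdI)
qed

theorem theorem4p7:
  fixes n d :: nat
    and L :: "(complex ^ 'n::finite) set"
    and A :: "complex ^ 'n ^ 'm::finite"
    and \<Delta> :: "'n cpoly"
  assumes "CARD('n) = n + 1" and "CARD('m) = d + 1"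
    and "vec.subspace L" and "vec.dim L = d + 1" and "d < n"
    and "\<forall>i. \<not> L \<subseteq> {x. x $ i = 0}"
    and "vec.span (rows A) = L"
    and "\<not> (\<exists>j. is_coloop (column_matroid A) j)"
    and "is_hypersurface (matroid_discriminant_variety L)"
    and "is_defining_polynomial \<Delta> (matroid_discriminant_variety L)"
  shows "\<exists>k::nat. k > 0 \<and> newton_polytope \<Delta> = (\<lambda>x. real k *\<^sub>R x) ` standard_simplex"
proof -
  obtain k where irr: "irreducible \<Delta>" and hom: "homogeneous k \<Delta>"
    and zeros: "matroid_discriminant_variety L = proj_zeros {\<Delta>}"
    using assms(10) by (auto simp: is_defining_polynomial_def)
  have "eval_cpoly \<Delta> (axis i 1) \<noteq> 0" for i
    using axis_notin_discriminant_variety[OF assms(3), of i] assms(6)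
    by (auto simp: zeros proj_zeros_def axis_eq_0_iff)
  then have key: "Poly_Mapping.single i k \<in> Poly_Mapping.keys \<Delta>" for i
    by (intro axis_exponent_in_keys[OF hom])
  have "k > 0"
    using irr hom homogeneous_zero_dvd_one[of \<Delta>] by (auto simp: irreducible_def intro: gr0I)
  with newton_polytope_eq_dilated_simplex[OF hom _ key] show ?thesis by blast
qed

end
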